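(* Let $\mathbb{D}$ be the closed unit disc in the Euclidean plane $\mathbb{R}^2$ and let $f\colon\mathbb{D}\to\mathbb{D}$ be a light saddle map (regarded as a map into $\mathbb{R}^2$). Assume that the restriction $f|_{\partial\mathbb{D}}$ is the identity map. Then $f$ is a homeomorphism.
   Context: Maps are assumed to be continuous. A map $f$ from the closed unit disc $\mathbb{D}$ to a Euclidean space is called saddle if for any (affine) hyperplane $\Pi$ of the Euclidean space, each connected component of the complement $\mathbb{D}\setminus f^{-1}(\Pi)$ intersects the boundary $\partial\mathbb{D}$; for the target $\mathbb{R}^2$ hyperplanes are straight lines. A continuous map $f\colon X\to Y$ is called light if the inverse image $f^{-1}\{y\}$ of any point $y\in Y$ is totally disconnected. *)

theory Defs
  imports "HOL-Analysis.Analysis"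
begin

abbreviation closed_disc :: "(real^2) set" ("\<bbbD>")
  where "\<bbbD> \<equiv> cball 0 1"

abbreviation disc_boundary :: "(real^2) set" ("\<partial>\<bbbD>")
  where "\<partial>\<bbbD> \<equiv> sphere 0 1"

definition affine_hyperplane :: "'a::euclidean_space set \<Rightarrow> bool"
  where "affine_hyperplane H \<longleftrightarrow> (\<exists>a b. a \<noteq> 0 \<and> H = {x. a \<bullet> x = b})"

definition saddle_map :: "(real^2 \<Rightarrow> 'a::euclidean_space) \<Rightarrow> bool"
  where "saddle_map f \<longleftrightarrow> continuous_on \<bbbD> f \<and>
    (\<forall>H. affine_hyperplane H \<longrightarrow> (\<forall>C \<in> components (\<bbbD> - f -` H). C \<inter> \<partial>\<bbbD> \<noteq> {}))"

definition totally_disconnected :: "'a::topological_space set \<Rightarrow> bool"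
  where "totally_disconnected S \<longleftrightarrow> (\<forall>C \<in> components S. \<exists>x. C = {x})"

definition light_on :: "'a::topological_space set \<Rightarrow> ('a \<Rightarrow> 'b::topological_space) \<Rightarrow> bool"
  where "light_on X f \<longleftrightarrow> continuous_on X f \<and> (\<forall>y. totally_disconnected (X \<inter> f -` {y}))"

end

theory Submission
  imports Defs
begin

text \<open>
  The saddle condition makes the preimage of every open half-plane connected, since each of its
  components meets the circle in the same arc. Let \<open>f x = f y = p\<close> with \<open>p\<close> interior. For a
  half-plane missing \<open>p\<close>, the points \<open>x\<close> and \<open>y\<close> are joined by a path in the preimage of the
  opposite half-plane, so \<open>(z - x) / (z - y)\<close> has a continuous logarithm on the preimage of the
  given one. Normalised to agree with a fixed logarithm on the circle, these local branches do not
  change when the half-plane is moved, hence glue to a logarithm off the fibre of \<open>p\<close>. If the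
  fibre split into two closed parts containing \<open>x\<close> and \<open>y\<close> respectively, this logarithm would
  allow \<open>z - y\<close> to be deformed into \<open>z - x\<close> between the parts, which extends \<open>z - y\<close> from the
  circle to the disc without zeros; this is impossible. So fibres are connected, and lightness
  makes them points.
\<close>

section \<open>Identification of the plane with the complex numbers\<close>

definition cplx :: "real^2 \<Rightarrow> complex"
  where "cplx v = Complex (v $ 1) (v $ 2)"

definition uncplx :: "complex \<Rightarrow> real^2"
  where "uncplx w = Re w *\<^sub>R axis 1 1 + Im w *\<^sub>R axis 2 1"

lemma norm_vec2: "norm (v :: real^2) = sqrt ((v $ 1)\<^sup>2 + (v $ 2)\<^sup>2)"
  by (simp add: norm_vec_def L2_set_def sum_2)

lemma norm_cplx: "norm (cplx v) = norm v"
  by (simp add: cplx_def norm_vec2 complex_norm)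

lemma uncplx_cplx: "uncplx (cplx v) = v"
  by (simp add: uncplx_def cplx_def vec_eq_iff forall_2 axis_def)

lemma norm_uncplx: "norm (uncplx w) = norm w"
  by (simp add: norm_vec2 uncplx_def axis_def cmod_def)

lemma cplx_eq_0_iff: "cplx v = 0 \<longleftrightarrow> v = 0"
  by (metis norm_cplx norm_eq_zero)

lemma continuous_on_cplx [continuous_intros]:
  "continuous_on S g \<Longrightarrow> continuous_on S (\<lambda>x. cplx (g x))"
  unfolding cplx_def Complex_eq by (intro continuous_intros)

lemma continuous_on_uncplx [continuous_intros]:
  "continuous_on S g \<Longrightarrow> continuous_on S (\<lambda>x. uncplx (g x))"
  unfolding uncplx_def by (intro continuous_intros)

section \<open>Zeros forced by boundary values\<close>

text \<open>Dividing a zero-free \<open>h\<close> by its norm would extend the Borsuk map of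
  \<open>y\<close>, the unit direction from \<open>y\<close>, from the circle to the disc. This is
  impossible because \<open>y\<close> lies in a bounded component of the complement of the
  circle.\<close>

lemma zero_of_disc_extension:
  fixes h :: "real^2 \<Rightarrow> complex"
  assumes h: "continuous_on \<bbbD> h" and y: "norm y < 1"
    and bd: "\<And>z. z \<in> \<partial>\<bbbD> \<Longrightarrow> h z = cplx (z - y)"
  shows "\<exists>z\<in>\<bbbD>. h z = 0"
proof (rule ccontr)
  assume "\<not> ?thesis"
  then have nz: "\<And>z. z \<in> \<bbbD> \<Longrightarrow> h z \<noteq> 0" by blast
  define g where "g z = inverse (norm (h z)) *\<^sub>R uncplx (h z)" for z
  have D: "sphere 0 1 \<union> ball 0 1 = (cball 0 1 :: (real^2) set)" by auto
  have comp: "ball (0::real^2) 1 \<in> components (- sphere 0 1)"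
    unfolding in_components_maximal
  proof (intro conjI allI impI)
    fix T :: "(real^2) set"
    assume T: "T \<noteq> {} \<and> ball 0 1 \<subseteq> T \<and> T \<subseteq> - sphere 0 1 \<and> connected T"
    have "T - ball 0 1 = {}"
    proof (rule ccontr)
      assume "T - ball 0 1 \<noteq> {}"
      moreover have "0 \<in> T \<inter> ball 0 1"
        using T by (metis IntI centre_in_ball subsetD zero_less_one)
      ultimately have "T \<inter> frontier (ball 0 1) \<noteq> {}"
        using T by (intro connected_Int_frontier) auto
      then show False using T by auto
    qed
    then show "T = ball 0 1" using T by auto
  qed auto
  show False
  proof (rule notE[OF non_extensible_Borsuk_map[OF compact_sphere comp bounded_ball, of y]])
    show "y \<in> ball 0 1" using y by simp
    have "continuous_on \<bbbD> g"
      unfolding g_def using nz by (intro continuous_intros h) auto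
    moreover have "g \<in> \<bbbD> \<rightarrow> sphere 0 1"
      using nz by (auto simp: g_def norm_uncplx)
    moreover have "\<forall>x\<in>\<partial>\<bbbD>. g x = inverse (norm (x - y)) *\<^sub>R (x - y)"
      using bd by (simp add: g_def norm_cplx uncplx_cplx)
    ultimately show "\<exists>g. continuous_on (sphere 0 1 \<union> ball 0 1) g \<and> g \<in> (sphere 0 1 \<union> ball 0 1) \<rightarrow> sphere 0 1 \<and>
       (\<forall>x\<in>\<partial>\<bbbD>. g x = inverse (norm (x - y)) *\<^sub>R (x - y))"
      unfolding D by blast
  qed
qed

section \<open>Paths and continuous logarithms\<close>

text \<open>Turns connectedness of half-plane preimages, which are relatively open in the disc, into
  actual paths.\<close>

lemma connected_openin_convex_imp_path_connected:
  fixes S :: "'a::real_normed_vector set"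
  assumes "convex K" "openin (top_of_set K) S" "connected S"
  shows "path_connected S"
proof -
  have "locally path_connected S"
    using assms convex_imp_locally_path_connected locally_open_subset by blast
  then show ?thesis
    using assms(3) by (simp add: path_connected_component connected_iff_connected_component
        path_component_eq_connected_component)
qed

text \<open>Sliding the centre of the numerator from \<open>y\<close> to \<open>x\<close> along a
  path in \<open>Z\<close> creates no zero on \<open>S\<close>. Hence the quotient is homotopic to
  the constant 1 in the punctured plane, and null-homotopic maps into it have logarithms.\<close>

lemma continuous_log_quotient:
  assumes "path_connected Z" "x \<in> Z" "y \<in> Z" "S \<inter> Z = {}"
  obtains g where "continuous_on S g" "\<And>z. z \<in> S \<Longrightarrow> cplx (z - x) / cplx (z - y) = exp (g z)"
proof -
  obtain q where q: "path q" "path_image q \<subseteq> Z" "pathstart q = y" "pathfinish q = x"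
    using assms unfolding path_connected_def by blast
  have avoid: "q t \<notin> S" if "0 \<le> t" "t \<le> 1" for t
    using q(2) that assms(4) by (fastforce simp: path_image_def)
  have y: "cplx (z - y) \<noteq> 0" if "z \<in> S" for z
    using assms that by (auto simp: cplx_eq_0_iff)
  let ?h = "\<lambda>p. cplx (snd p - q (fst p)) / cplx (snd p - y)"
  have "continuous_on ({0..1} \<times> S) (\<lambda>p. q (fst p))"
    by (rule continuous_on_compose2[OF q(1)[unfolded path_def]]) (auto intro!: continuous_intros)
  then have "continuous_on ({0..1} \<times> S) ?h"
    using y by (intro continuous_intros) auto
  then have "homotopic_with_canon (\<lambda>h. True) S (-{0}) (\<lambda>z. 1) (\<lambda>z. cplx (z - x) / cplx (z - y))"
    using y avoid q(3,4) \<open>y \<in> Z\<close> \<open>S \<inter> Z = {}\<close>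
    by (subst homotopic_with, simp, intro exI[of _ ?h])
      (auto simp: pathstart_def pathfinish_def cplx_eq_0_iff prod_topology_subtopology_eu)
  then have "\<exists>a. homotopic_with_canon (\<lambda>h. True) S (-{0}) (\<lambda>z. cplx (z - x) / cplx (z - y)) (\<lambda>t. a)"
    using homotopic_with_symD by blast
  then show ?thesis
    using that unfolding inessential_eq_continuous_logarithm by blast
qed

text \<open>The difference takes values in the integer multiples of \<open>2 * pi * \<i>\<close>,
  which are at least \<open>2 * pi\<close> apart, so it cannot vary on a connected set.\<close>

lemma continuous_logs_diff_constant:
  fixes g h :: "'a::topological_space \<Rightarrow> complex"
  assumes "connected S" "continuous_on S g" "continuous_on S h"
    and e: "\<And>z. z \<in> S \<Longrightarrow> exp (g z) = exp (h z)"
    and "b \<in> S" "z \<in> S"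
  shows "g z - h z = g b - h b"
proof -
  have k: "\<exists>n::int. g z - h z = of_int n * (2 * pi * \<i>)" if "z \<in> S" for z
    using e[OF that] unfolding exp_eq by (auto simp: algebra_simps)
  have "(\<lambda>z. g z - h z) constant_on S"
  proof (rule continuous_discrete_range_constant[OF assms(1)])
    show "continuous_on S (\<lambda>z. g z - h z)" by (intro continuous_intros assms)
    fix x assume x: "x \<in> S"
    show "\<exists>e>0. \<forall>y. y \<in> S \<and> g y - h y \<noteq> g x - h x \<longrightarrow> e \<le> norm (g y - h y - (g x - h x))"
    proof (intro exI[of _ "2*pi"] conjI allI impI)
      fix y assume y: "y \<in> S \<and> g y - h y \<noteq> g x - h x"
      obtain m n :: int where mn: "g x - h x = of_int m * (2 * pi * \<i>)" "g y - h y = of_int n * (2 * pi * \<i>)"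
        using k x y by meson
      then have "n \<noteq> m" using y by auto
      have "g y - h y - (g x - h x) = of_int (n - m) * (2 * pi * \<i>)"
        unfolding mn by (simp add: algebra_simps)
      then have "norm (g y - h y - (g x - h x)) = \<bar>of_int (n - m)\<bar> * (2 * pi)"
        by (simp add: norm_mult del: of_int_diff)
      also have "\<dots> \<ge> 1 * (2*pi)"
        using \<open>n \<noteq> m\<close> by (intro mult_right_mono) (linarith, simp)
      finally show "2*pi \<le> norm (g y - h y - (g x - h x))" by simp
    qed simp
  qed
  then show ?thesis using assms(5,6) unfolding constant_on_def by metis
qed

section \<open>Half-planes and their preimages\<close>

text \<open>If nonempty, the set is symmetric about the direction of \<open>a\<close>: two graphs
  over one interval, meeting at the unit vector in that direction.\<close>

lemma connected_circle_halfplane: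
  fixes a :: "real^2"
  assumes "a \<noteq> 0"
  shows "connected {z \<in> \<partial>\<bbbD>. a \<bullet> z > b}"
proof (cases "norm a > b")
  case False
  have "{z \<in> \<partial>\<bbbD>. a \<bullet> z > b} = {}"
    using False by (force dest: order_less_le_trans[OF _ norm_cauchy_schwarz])
  then show ?thesis by (metis connected_empty)
next
  case True
  define u v where "u = a /\<^sub>R norm a" and "v = (vector [- u $ 2, u $ 1] :: real^2)"
  have nu: "(u $ 1)\<^sup>2 + (u $ 2)\<^sup>2 = 1"
    using assms norm_vec2[of u] by (simp add: u_def)
  have au: "a \<bullet> z = norm a * (u \<bullet> z)" for z
    using assms by (simp add: u_def)
  have uv: "u \<bullet> u = 1" "u \<bullet> v = 0" "v \<bullet> v = 1"
    using nu by (simp_all add: v_def inner_vec_def sum_2 power2_eq_square)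
  \<comment> \<open>\<open>t\<close> is the coordinate along \<open>u\<close>; the sign
    \<open>e\<close> selects one of the two half circles with endpoints \<open>u\<close> and
    \<open>- u\<close>.\<close>
  define \<gamma> where "\<gamma> e t = t *\<^sub>R u + (e * sqrt (1 - t\<^sup>2)) *\<^sub>R v" for e t :: real
  define I where "I = {t. -1 \<le> t \<and> t \<le> 1 \<and> norm a * t > b}"
  have I: "connected I"
  proof -
    have "I = {-1..1} \<inter> {b / norm a <..}" using assms by (auto simp: I_def field_simps)
    then show ?thesis by (simp add: convex_Int convex_connected)
  qed
  have "1 \<in> I" using True by (simp add: I_def)
  have "{z \<in> \<partial>\<bbbD>. a \<bullet> z > b} = \<gamma> 1 ` I \<union> \<gamma> (-1) ` I"
  proof (intro equalityI subsetI)
    fix z assume z: "z \<in> {z \<in> \<partial>\<bbbD>. a \<bullet> z > b}"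
    define t s where "t = u \<bullet> z" and "s = v \<bullet> z"
    have zz: "z = t *\<^sub>R u + s *\<^sub>R v"
    proof -
      have "z $ 1 = z $ 1 * ((u $ 1)\<^sup>2 + (u $ 2)\<^sup>2)" "z $ 2 = z $ 2 * ((u $ 1)\<^sup>2 + (u $ 2)\<^sup>2)"
        using nu by simp_all
      then show ?thesis
        unfolding t_def s_def v_def vec_eq_iff forall_2 inner_vec_def sum_2
        by (simp add: algebra_simps power2_eq_square)
    qed
    have "z \<bullet> z = 1" using z by (simp add: norm_eq_1)
    then have ts: "t\<^sup>2 + s\<^sup>2 = 1"
      using uv unfolding zz by (simp add: inner_add inner_commute power2_eq_square)
    then have "t\<^sup>2 \<le> 1" using zero_le_power2[of s] by linarith
    then have "t \<in> I" using z au[of z] abs_square_le_1[of t] by (auto simp: I_def t_def[symmetric])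
    moreover have "s = sqrt (1 - t\<^sup>2) \<or> s = - sqrt (1 - t\<^sup>2)"
      using ts by (metis abs_if add_diff_cancel_left' minus_equation_iff real_sqrt_abs)
    ultimately show "z \<in> \<gamma> 1 ` I \<union> \<gamma> (-1) ` I"
      using zz by (auto simp: \<gamma>_def)
  next
    have "\<gamma> e t \<in> {z \<in> \<partial>\<bbbD>. a \<bullet> z > b}" if "t \<in> I" "e = 1 \<or> e = -1" for e t
    proof -
      have "t\<^sup>2 \<le> 1" using that by (auto simp: I_def abs_square_le_1)
      then have "\<gamma> e t \<bullet> \<gamma> e t = 1"
        using uv that(2) by (auto simp: \<gamma>_def inner_add inner_commute power2_eq_square[symmetric])
      then show ?thesis
        using that(1) uv by (simp add: norm_eq_1 au I_def) (simp add: \<gamma>_def inner_add)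
    qed
    then show "z \<in> {z \<in> \<partial>\<bbbD>. a \<bullet> z > b}" if "z \<in> \<gamma> 1 ` I \<union> \<gamma> (-1) ` I" for z
      using that by blast
  qed
  moreover have conn: "connected (\<gamma> e ` I)" for e
    unfolding \<gamma>_def by (intro connected_continuous_image I continuous_intros)
  moreover have "\<gamma> 1 1 = \<gamma> (-1) 1" by (simp add: \<gamma>_def)
  then have "\<gamma> 1 1 \<in> \<gamma> 1 ` I \<inter> \<gamma> (-1) ` I" using \<open>1 \<in> I\<close> by (metis IntI imageI)
  then have "connected (\<gamma> 1 ` I \<union> \<gamma> (-1) ` I)"
    by (intro connected_Un[OF conn conn]) blast
  ultimately show ?thesis by (simp only:)
qed

text \<open>A component of the complement of the preimage of the line stays on one side, since its
  image misses the line. By the saddle condition it reaches the circle, where \<open>f\<close> is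
  the identity, hence it reaches the arc cut off by the half-plane. This connected arc ties all the
  components together.\<close>

lemma connected_saddle_halfplane:
  fixes f :: "real^2 \<Rightarrow> real^2"
  assumes f: "saddle_map f" "\<forall>x \<in> \<partial>\<bbbD>. f x = x" and "a \<noteq> 0"
  shows "connected {z \<in> \<bbbD>. a \<bullet> f z > b}" (is "connected ?U")
    and "\<And>z. z \<in> \<bbbD> \<Longrightarrow> a \<bullet> f z > b \<Longrightarrow> \<exists>w\<in>\<partial>\<bbbD>. a \<bullet> w > b"
proof -
  let ?H = "{w. a \<bullet> w = b}" and ?A = "{z \<in> \<partial>\<bbbD>. a \<bullet> z > b}"
  define X where "X = \<bbbD> - f -` ?H"
  let ?C = "connected_component_set X"
  have cont: "continuous_on \<bbbD> f" using f by (simp add: saddle_map_def)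
  have A: "?A \<subseteq> ?U" using f(2) by auto
  have key: "?C z \<subseteq> ?U \<and> ?C z \<inter> ?A \<noteq> {} \<and> z \<in> ?C z" if z: "z \<in> ?U" for z
  proof -
    have zX: "z \<in> X" using z by (auto simp: X_def)
    have CX: "?C z \<subseteq> X" by (rule connected_component_subset)
    have "connected ((\<lambda>z. a \<bullet> f z) ` ?C z)"
      by (intro connected_continuous_image continuous_intros continuous_on_subset[OF cont]
          connected_connected_component) (use CX in \<open>auto simp: X_def\<close>)
    moreover have "b \<notin> (\<lambda>z. a \<bullet> f z) ` ?C z" using CX by (auto simp: X_def)
    moreover have zC: "z \<in> ?C z" using zX by simp
    ultimately have "a \<bullet> f w > b" if "w \<in> ?C z" for w
      using connected_contains_Icc[of "(\<lambda>z. a \<bullet> f z) ` ?C z" "a \<bullet> f w" "a \<bullet> f z"] that z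
      by (force simp: not_less[symmetric])
    then have sub: "?C z \<subseteq> ?U" using CX by (auto simp: X_def)
    have "?C z \<in> components X" using zX by (auto simp: components_def)
    then have "?C z \<inter> \<partial>\<bbbD> \<noteq> {}"
      using f(1) \<open>a \<noteq> 0\<close> unfolding saddle_map_def affine_hyperplane_def X_def by blast
    then show ?thesis using sub f(2) zC by fastforce
  qed
  then show "\<exists>w\<in>\<partial>\<bbbD>. a \<bullet> w > b" if "z \<in> \<bbbD>" "a \<bullet> f z > b" for z
    using that by blast
  show "connected ?U"
  proof (cases "?U = {}")
    case False
    then obtain w where w: "w \<in> ?A" using key by blast
    have "?U = (\<Union>z\<in>?U. ?C z \<union> ?A)" using key A by blast
    moreover have "connected (\<Union>z\<in>?U. ?C z \<union> ?A)"
    proof (rule connected_Union)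
      fix S assume "S \<in> (\<lambda>z. ?C z \<union> ?A) ` ?U"
      then show "connected S"
        using connected_circle_halfplane[OF \<open>a \<noteq> 0\<close>] key by (auto intro!: connected_Un)
    qed (use w in auto)
    ultimately show ?thesis by simp
  qed (metis connected_empty)
qed


lemma openin_disc_halfplane:
  fixes f :: "real^2 \<Rightarrow> real^2"
  assumes "continuous_on \<bbbD> f"
  shows "openin (top_of_set \<bbbD>) {z \<in> \<bbbD>. a \<bullet> f z > b}"
proof -
  have "openin (top_of_set \<bbbD>) (\<bbbD> \<inter> (\<lambda>z. a \<bullet> f z) -` {b<..})"
    by (intro continuous_openin_preimage_gen continuous_intros assms)
  then show ?thesis by (simp add: vimage_def Int_def)
qed

section \<open>Gluing logarithms off a fibre\<close>

text \<open>Each half-plane gives a logarithm only up to a period. Prescribing it on the circle,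
  which every nonempty \<open>V a\<close> meets, makes the branches comparable.\<close>

lemma log_quotient_off_fiber:
  fixes f :: "real^2 \<Rightarrow> real^2"
  assumes f: "saddle_map f" "\<forall>x \<in> \<partial>\<bbbD>. f x = x"
    and x: "norm x < 1" "f x = p" and y: "norm y < 1" "f y = p"
  obtains L where "continuous_on (\<bbbD> - f -` {p}) L"
    "\<And>z. z \<in> \<bbbD> - f -` {p} \<Longrightarrow> cplx (z - x) / cplx (z - y) = exp (L z)"
proof -
  define Q where "Q z = cplx (z - x) / cplx (z - y)" for z
  \<comment> \<open>The vector \<open>a\<close> encodes both the direction and the distance from \<open>p\<close> of the half-plane.\<close>
  define V where "V a = {z \<in> \<bbbD>. a \<bullet> f z > 1 + a \<bullet> p}" for a
  have contf: "continuous_on \<bbbD> f" using f by (simp add: saddle_map_def)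
  \<comment> \<open>The circle misses the open disc, where \<open>x\<close> and \<open>y\<close> can
    be joined; the resulting \<open>L0\<close> is the common reference for all local
    branches.\<close>
  have "\<partial>\<bbbD> \<inter> ball 0 1 = {}" by auto
  then obtain L0 where L0: "continuous_on \<partial>\<bbbD> L0" "\<And>z. z \<in> \<partial>\<bbbD> \<Longrightarrow> Q z = exp (L0 z)"
    using continuous_log_quotient[OF convex_imp_path_connected[OF convex_ball], of x 0 1 y "\<partial>\<bbbD>"] x y
    unfolding Q_def by (auto simp del: mem_sphere)
  have Vopen: "openin (top_of_set \<bbbD>) (V a)" for a
    unfolding V_def by (rule openin_disc_halfplane[OF contf])
  have V0: "a \<noteq> 0" if "z \<in> V a" for a z using that by (auto simp: V_def)
  have Vconn: "connected (V a)" if "z \<in> V a" for a z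
    unfolding V_def by (rule connected_saddle_halfplane(1)[OF f V0[OF that]])
  have Vbd: "\<exists>b. b \<in> \<partial>\<bbbD> \<and> b \<in> V a" if "z \<in> V a" for a z
    using connected_saddle_halfplane(2)[OF f V0[OF that], of z "1 + a \<bullet> p"] that f(2) by (force simp: V_def)
  have "\<exists>g. continuous_on (V a) g \<and> (\<forall>z \<in> V a. Q z = exp (g z)) \<and> (\<forall>w \<in> \<partial>\<bbbD> \<inter> V a. g w = L0 w)" for a
  proof (cases "V a = {}")
    case False
    then obtain b where b: "b \<in> \<partial>\<bbbD>" "b \<in> V a" using Vbd by blast
    have "- a \<noteq> 0" using V0 b by auto
    \<comment> \<open>The preimage of the opposite half-plane
      \<open>a \<bullet> w < 1 + a \<bullet> p\<close>, which contains \<open>p\<close>.\<close>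
    define W where "W = {z \<in> \<bbbD>. - a \<bullet> f z > - (1 + a \<bullet> p)}"
    have W: "path_connected W"
      using connected_openin_convex_imp_path_connected[OF convex_cball openin_disc_halfplane[OF contf]
          connected_saddle_halfplane(1)[OF f \<open>- a \<noteq> 0\<close>]] unfolding W_def .
    have "V a \<inter> W = {}" "x \<in> W" "y \<in> W"
      using x y by (auto simp: V_def W_def)
    then obtain g where g: "continuous_on (V a) g" "\<And>z. z \<in> V a \<Longrightarrow> Q z = exp (g z)"
      using continuous_log_quotient[OF W, of x y "V a"] unfolding Q_def by blast
    let ?A = "{z \<in> \<partial>\<bbbD>. a \<bullet> z > 1 + a \<bullet> p}"
    have A: "?A = \<partial>\<bbbD> \<inter> V a" using f(2) by (auto simp: V_def)
    have "g z - L0 z = g b - L0 b" if "z \<in> \<partial>\<bbbD> \<inter> V a" for z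
    proof (rule continuous_logs_diff_constant[of "\<partial>\<bbbD> \<inter> V a"])
      show "connected (\<partial>\<bbbD> \<inter> V a)"
        unfolding A[symmetric] by (rule connected_circle_halfplane) (use \<open>- a \<noteq> 0\<close> in simp)
      show "continuous_on (\<partial>\<bbbD> \<inter> V a) g" "continuous_on (\<partial>\<bbbD> \<inter> V a) L0"
        using g L0 continuous_on_subset by blast+
      show "exp (g z) = exp (L0 z)" if "z \<in> \<partial>\<bbbD> \<inter> V a" for z
        using that g(2) L0(2) by (metis IntD1 IntD2)
    qed (use that b in auto)
    moreover have "exp (g b) = exp (L0 b)" using b g(2) L0(2) by metis
    ultimately show ?thesis
      \<comment> \<open>Both \<open>g b\<close> and \<open>L0 b\<close> are logarithms of
        \<open>Q b\<close>, so the subtracted constant is a period of \<open>exp\<close>.\<close>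
      by (intro exI[of _ "\<lambda>z. g z - (g b - L0 b)"])
        (auto intro!: continuous_intros g(1) simp: g(2) exp_diff diff_eq_eq)
  qed simp
  then obtain La where La: "\<And>a. continuous_on (V a) (La a)" "\<And>a z. z \<in> V a \<Longrightarrow> Q z = exp (La a z)"
      "\<And>a w. w \<in> \<partial>\<bbbD> \<Longrightarrow> w \<in> V a \<Longrightarrow> La a w = L0 w"
    by (metis IntI)
  \<comment> \<open>For fixed \<open>z\<close> the admissible \<open>a\<close> form a half-space, and \<open>La a z\<close> is locally constant in \<open>a\<close>:
    a path in \<open>V a\<close> from \<open>z\<close> to the circle stays in \<open>V a'\<close> for nearby \<open>a'\<close>.\<close>
  have agree: "La a z = La a' z" if "z \<in> V a" "z \<in> V a'" for z a a'
  proof -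
    define S where "S = {a. z \<in> V a}"
    have zD: "z \<in> \<bbbD>" using that by (simp add: V_def)
    have S_eq: "S = {a. (f z - p) \<bullet> a > 1}"
      using zD by (auto simp: S_def V_def inner_diff_left inner_diff_right inner_commute)
    have "(\<lambda>a. La a z) constant_on S"
    proof (rule locally_constant_imp_constant)
      show "connected S" unfolding S_eq by (intro convex_connected convex_halfspace_gt)
      fix a assume "a \<in> S"
      then have za: "z \<in> V a" by (simp add: S_def)
      then obtain b where b: "b \<in> \<partial>\<bbbD>" "b \<in> V a" using Vbd by blast
      have "path_connected (V a)"
        by (rule connected_openin_convex_imp_path_connected[OF convex_cball Vopen Vconn[OF za]])
      then obtain q where q: "path q" "path_image q \<subseteq> V a" "pathstart q = z" "pathfinish q = b"
        using za b unfolding path_connected_def by blast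
      define T where "T = path_image q"
      have T: "compact T" "connected T" "z \<in> T" "b \<in> T" "T \<subseteq> V a" "T \<subseteq> \<bbbD>"
        using q by (auto simp: T_def V_def)
      have contT: "continuous_on T f" using contf T(6) continuous_on_subset by blast
      obtain t0 where t0: "t0 \<in> T" "\<And>t. t \<in> T \<Longrightarrow> a \<bullet> (f t0 - p) \<le> a \<bullet> (f t - p)"
        using continuous_attains_inf[of T "\<lambda>t. a \<bullet> (f t - p)"] T
        by (fastforce intro!: continuous_intros contT)
      \<comment> \<open>The minimum is attained in \<open>V a\<close>, hence exceeds 1. Moving
        \<open>a\<close> to \<open>a'\<close> changes \<open>a \<bullet> (f t - p)\<close> by at
        most \<open>norm (a - a') * B\<close>, so the radius \<open>(m - 1) / B\<close> keeps it
        above 1 along all of \<open>T\<close>.\<close>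
      define m where "m = a \<bullet> (f t0 - p)"
      have m: "m > 1" using t0(1) T(5) by (auto simp: m_def V_def inner_diff_right)
      have "bounded ((\<lambda>t. f t - p) ` T)"
        by (intro compact_imp_bounded compact_continuous_image continuous_intros contT T)
      then obtain B where B: "B > 0" "\<And>t. t \<in> T \<Longrightarrow> norm (f t - p) \<le> B"
        unfolding bounded_pos by auto
      have TV: "T \<subseteq> V a'" if "a' \<in> ball a ((m - 1) / B)" for a'
      proof
        fix t assume t: "t \<in> T"
        have "\<bar>(a - a') \<bullet> (f t - p)\<bar> \<le> norm (a - a') * B"
          using Cauchy_Schwarz_ineq2 B(2)[OF t] by (meson mult_left_mono norm_ge_zero order_trans)
        also have "\<dots> < m - 1" using that B(1) by (simp add: dist_norm field_simps)
        finally have "a' \<bullet> (f t - p) > 1" using t0(2)[OF t] by (simp add: m_def inner_diff_left abs_less_iff)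
        then show "t \<in> V a'" using t T(6) by (auto simp: V_def inner_diff_right)
      qed
      have "La a' z = La a z" if "a' \<in> ball a ((m - 1) / B)" for a'
      proof -
        \<comment> \<open>On the connected set \<open>T\<close> both branches are logarithms of
          \<open>Q\<close>, and at the boundary end \<open>b\<close> both are normalised to
          \<open>L0 b\<close>.\<close>
        have "La a' z - La a z = La a' b - La a b"
        proof (rule continuous_logs_diff_constant[OF T(2)])
          show "continuous_on T (La a')" "continuous_on T (La a)"
            by (rule continuous_on_subset[OF La(1)], fact TV[OF that] T(5))+
          show "exp (La a' w) = exp (La a w)" if "w \<in> T" for w
          proof -
            have "w \<in> V a'" "w \<in> V a" using TV[OF \<open>a' \<in> _\<close>] T(5) that by auto
            then show ?thesis by (simp flip: La(2))
          qed
        qed (use T in auto)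
        moreover have "b \<in> V a'" using TV[OF that] T(4) by blast
        ultimately show ?thesis using La(3)[OF b(1)] b(2) by simp
      qed
      moreover have "a \<in> S \<inter> ball a ((m - 1) / B)" using m B(1) \<open>a \<in> S\<close> by simp
      moreover have "openin (top_of_set S) (S \<inter> ball a ((m - 1) / B))"
        by (rule openin_open_Int) simp
      ultimately show "\<exists>T. openin (top_of_set S) T \<and> a \<in> T \<and> (\<forall>a'\<in>T. La a' z = La a z)"
        by blast
    qed
    moreover have "a \<in> S" "a' \<in> S" using that by (simp_all add: S_def)
    ultimately show ?thesis unfolding constant_on_def by metis
  qed
  let ?X = "\<bbbD> - f -` {p}"
  have VX: "V a \<subseteq> ?X" for a by (auto simp: V_def)
  have cover: "\<exists>a. z \<in> V a" if "z \<in> ?X" for z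
  proof -
    define v where "v = f z - p"
    have "v \<bullet> v > 0" using that by (simp add: v_def)
    \<comment> \<open>The scaling gives \<open>a \<bullet> (f z - p) = 2\<close>, beyond the
      threshold 1 in \<open>V\<close>.\<close>
    then have "((2 / (v \<bullet> v)) *\<^sub>R v) \<bullet> v = 2" by simp
    then have "z \<in> V ((2 / (v \<bullet> v)) *\<^sub>R v)"
      using that by (auto simp: V_def v_def inner_diff_right)
    then show ?thesis ..
  qed
  obtain L where L: "continuous_map (top_of_set ?X) euclidean L"
      "\<And>z a. a \<in> UNIV \<Longrightarrow> z \<in> topspace (top_of_set ?X) \<inter> V a \<Longrightarrow> L z = La a z"
  proof (rule pasting_lemma_exists[where X = "top_of_set ?X" and I = UNIV and T = V and Y = euclidean and f = La])
    show "topspace (top_of_set ?X) \<subseteq> (\<Union>i\<in>UNIV. V i)" using cover by auto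
    show "openin (top_of_set ?X) (V a)" for a
      using Vopen VX by (meson Diff_subset openin_subset_trans)
    show "continuous_map (subtopology (top_of_set ?X) (V a)) euclidean (La a)" for a
      using La(1) VX by (simp add: subtopology_subtopology inf_absorb2)
  qed (use agree in auto)
  show ?thesis
  proof
    show "continuous_on ?X L" using L(1) by simp
    fix z assume z: "z \<in> ?X"
    then obtain a where "z \<in> V a" using cover by blast
    then show "cplx (z - x) / cplx (z - y) = exp (L z)"
      using La(2) L(2)[of a z] z by (simp add: Q_def)
  qed
qed

section \<open>Connectedness of the fibres\<close>

lemma connected_interior_fiber:
  fixes f :: "real^2 \<Rightarrow> real^2"
  assumes f: "saddle_map f" "\<forall>x \<in> \<partial>\<bbbD>. f x = x" and p: "norm p < 1"
  shows "connected (\<bbbD> \<inter> f -` {p})" (is "connected ?F")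
proof (rule ccontr)
  assume "\<not> connected ?F"
  then obtain x y where xy: "x \<in> ?F" "y \<in> ?F" "\<not> connected_component ?F x y"
    unfolding connected_iff_connected_component by blast
  have contf: "continuous_on \<bbbD> f" using f by (simp add: saddle_map_def)
  have closedF: "closedin (top_of_set \<bbbD>) ?F"
    by (rule continuous_closedin_preimage[OF contf closed_singleton])
  then have compF: "compact ?F"
    using closedin_compact compact_cball by blast
  have int: "norm z < 1" if "z \<in> ?F" for z
    using that p f(2) by (cases "norm z = 1") auto
  have "connected_component_set ?F x \<in> components ?F"
    using xy(1) by (auto simp: components_def)
  \<comment> \<open>In a compact set a component is the intersection of the clopen sets containing
    it, so one of them excludes \<open>y\<close>.\<close>
  from Sura_Bura_compact[OF compF this] xy(3)
  obtain T where T: "connected_component_set ?F x \<subseteq> T" "openin (top_of_set ?F) T"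
      "closedin (top_of_set ?F) T" "y \<notin> T"
    by blast
  have xT: "x \<in> T" using T(1) xy(1) by auto
  define F2 where "F2 = ?F - T"
  have TF: "T \<subseteq> ?F" using T(2) openin_imp_subset by blast
  have clT: "closed T" and clF2: "closed F2"
    using T(2,3) compF unfolding F2_def
    by (meson closedin_closed_trans closedin_diff closedin_subtopology_refl compact_imp_closed openin_closedin_eq closedin_self)+
  have F_eq: "?F = T \<union> F2" using TF by (auto simp: F2_def)
  \<comment> \<open>The circle misses the whole fibre, as its points are fixed and \<open>p\<close>
    is interior; so \<open>\<psi>\<close> may be made to vanish on the circle too.\<close>
  have "(T \<union> \<partial>\<bbbD>) \<inter> F2 = {}" using int by (force simp: F2_def)
  with clT clF2 obtain \<psi> :: "real^2 \<Rightarrow> real" where \<psi>: "continuous_on UNIV \<psi>"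
      "\<And>z. z \<in> T \<union> \<partial>\<bbbD> \<Longrightarrow> \<psi> z = 0" "\<And>z. z \<in> F2 \<Longrightarrow> \<psi> z = 1"
    using Urysohn[of "T \<union> \<partial>\<bbbD>" F2 0 "1::real"] by (metis closed_Un closed_sphere)
  \<comment> \<open>The truncation makes \<open>\<phi>\<close> constant near the fibre, where \<open>L\<close> may be unbounded.\<close>
  define \<phi> where "\<phi> z = max 0 (min 1 (3 * \<psi> z - 1))" for z
  have cont\<phi>: "continuous_on S \<phi>" for S
    unfolding \<phi>_def by (intro continuous_intros continuous_on_subset[OF \<psi>(1)]) auto
  obtain L where L: "continuous_on (\<bbbD> - f -` {p}) L"
    "\<And>z. z \<in> \<bbbD> - f -` {p} \<Longrightarrow> cplx (z - x) / cplx (z - y) = exp (L z)"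
    using log_quotient_off_fiber[OF f, of x p y] xy int by auto
  \<comment> \<open>The last branch is \<open>z - y\<close> where \<open>\<phi>\<close> is 0 and
    \<open>z - x\<close> where \<open>\<phi>\<close> is 1. On the fibre, where \<open>L\<close> is
    not controlled, these values are prescribed directly.\<close>
  define h where "h z = (if z \<in> T then cplx (z - y) else if z \<in> F2 then cplx (z - x)
      else cplx (z - y) * exp (of_real (\<phi> z) * L z))" for z
  \<comment> \<open>The truncation makes \<open>\<phi>\<close> equal to 0 on \<open>?Lo\<close> and
    1 on \<open>?Hi\<close>. These are neighbourhoods of \<open>T\<close> and \<open>F2\<close> in
    the disc, so together with \<open>?U\<close> they cover it.\<close>
  let ?Lo = "\<bbbD> \<inter> \<psi> -` {..<1/3}" and ?Hi = "\<bbbD> \<inter> \<psi> -` {2/3<..}" and ?U = "\<bbbD> - f -` {p}"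
  have h0: "h z = cplx (z - y)" if "z \<in> ?Lo" for z
  proof -
    have "z \<notin> F2" "\<phi> z = 0" using that \<psi>(3)[of z] by (auto simp: \<phi>_def)
    then show ?thesis by (simp add: h_def)
  qed
  have h1: "h z = cplx (z - x)" if "z \<in> ?Hi" for z
  proof -
    have "z \<notin> T" "\<phi> z = 1" using that \<psi>(2)[of z] by (auto simp: \<phi>_def)
    moreover have "cplx (z - y) * exp (L z) = cplx (z - x)" if "z \<notin> F2"
    proof -
      have "z \<in> ?U" using \<open>z \<in> ?Hi\<close> \<open>z \<notin> T\<close> that F_eq by blast
      moreover have "z \<noteq> y" using calculation xy by auto
      ultimately show ?thesis by (simp add: L(2)[symmetric] cplx_eq_0_iff)
    qed
    ultimately show ?thesis by (simp add: h_def)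
  qed
  have hU: "h z = cplx (z - y) * exp (of_real (\<phi> z) * L z)" if "z \<in> ?U" for z
  proof -
    have "z \<notin> T" "z \<notin> F2" using that F_eq by blast+
    then show ?thesis by (simp add: h_def)
  qed
  have "\<exists>z\<in>\<bbbD>. h z = 0"
  proof (rule zero_of_disc_extension)
    show "norm y < 1" using int xy by blast
    show "h z = cplx (z - y)" if "z \<in> \<partial>\<bbbD>" for z
      using h0[of z] that \<psi>(2)[of z] by auto
    have op: "openin (top_of_set \<bbbD>) ?Lo" "openin (top_of_set \<bbbD>) ?Hi"
      by (intro continuous_openin_preimage_gen continuous_on_subset[OF \<psi>(1)]; simp)+
    have opU: "openin (top_of_set \<bbbD>) ?U"
    proof -
      have "?U = \<bbbD> - ?F" by blast
      then show ?thesis using openin_diff[OF openin_subtopology_self closedF] by simp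
    qed
    have cont: "continuous_on ?Lo h" "continuous_on ?Hi h" "continuous_on ?U h"
      by (simp_all only: h0 h1 hU cong: continuous_on_cong)
        (intro continuous_intros L cont\<phi>)+
    have cover: "\<exists>U\<in>{?Lo, ?Hi, ?U}. z \<in> U" if "z \<in> \<bbbD>" for z
    proof (cases "z \<in> ?U")
      case False
      then have "\<psi> z = 0 \<or> \<psi> z = 1" using that F_eq \<psi>(2,3) by blast
      then show ?thesis using that by auto
    qed auto
    have "continuous_map (top_of_set \<bbbD>) euclidean h"
    proof (rule pasting_lemma[where I = "{?Lo, ?Hi, ?U}" and T = "\<lambda>U. U" and f = "\<lambda>_. h"])
      show "openin (top_of_set \<bbbD>) U" if "U \<in> {?Lo, ?Hi, ?U}" for U
        using that op opU by blast
      show "continuous_map (subtopology (top_of_set \<bbbD>) U) euclidean h" if "U \<in> {?Lo, ?Hi, ?U}" for U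
      proof -
        have "U \<subseteq> \<bbbD>" "continuous_on U h" using that cont by blast+
        then show ?thesis by (simp add: subtopology_subtopology inf_absorb2)
      qed
      show "\<exists>U. U \<in> {?Lo, ?Hi, ?U} \<and> z \<in> U \<and> h z = h z" if "z \<in> topspace (top_of_set \<bbbD>)" for z
        using that cover by (simp only: topspace_euclidean_subtopology) blast
    qed simp
    then show "continuous_on \<bbbD> h" by simp
  qed
  then obtain z where z: "z \<in> \<bbbD>" "h z = 0" by blast
  show False
  proof (cases "z \<in> ?U")
    case True
    then have "z \<noteq> y" using xy by auto
    then show False using z hU[OF True] by (simp add: cplx_eq_0_iff)
  next
    case False
    then have "z \<in> T \<or> z \<in> F2 \<and> z \<notin> T" using z(1) F_eq by blast
    \<comment> \<open>Each fibre branch would vanish only at a point of the other part: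
      \<open>y\<close> is not in \<open>T\<close>, and \<open>x\<close> is not in
      \<open>F2\<close>.\<close>
    then have "z \<in> T \<and> z = y \<or> z \<in> F2 \<and> z = x" using z(2) by (auto simp: h_def cplx_eq_0_iff)
    then show False using xT T(4) by (auto simp: F2_def)
  qed
qed

text \<open>The tangent line at \<open>p\<close> touches the disc only at \<open>p\<close>. So the
  fibre is the intersection of the decreasing compact connected sets \<open>S n\<close>, closures of
  preimages of half-planes cutting off shrinking caps at \<open>p\<close>.\<close>

lemma connected_boundary_fiber:
  fixes f :: "real^2 \<Rightarrow> real^2"
  assumes f: "saddle_map f" "\<forall>x \<in> \<partial>\<bbbD>. f x = x" and fD: "f ` \<bbbD> \<subseteq> \<bbbD>" and p: "norm p = 1"
  shows "connected (\<bbbD> \<inter> f -` {p})" (is "connected ?F")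
proof -
  define S where "S n = closure {z \<in> \<bbbD>. p \<bullet> f z > 1 - 1 / real (Suc n)}" for n
  have contf: "continuous_on \<bbbD> f" using f by (simp add: saddle_map_def)
  have cl: "closed {z \<in> \<bbbD>. p \<bullet> f z \<ge> b}" for b
  proof -
    have "closed (\<bbbD> \<inter> (\<lambda>z. p \<bullet> f z) -` {b..})"
      by (intro continuous_closed_preimage continuous_intros contf) auto
    then show ?thesis by (simp add: vimage_def Int_def)
  qed
  have S_sub: "S n \<subseteq> {z \<in> \<bbbD>. p \<bullet> f z \<ge> 1 - 1 / real (Suc n)}" for n
    unfolding S_def by (rule closure_minimal[OF _ cl]) auto
  have "connected (\<Inter>(range S))"
  proof (rule connected_nest)
    show "compact (S n)" for n
      using S_sub[of n] by (metis (no_types, lifting) S_def bounded_cball bounded_subset closed_closure compact_eq_bounded_closed mem_Collect_eq subset_eq)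
    show "connected (S n)" for n
      unfolding S_def
      by (intro connected_imp_connected_closure connected_saddle_halfplane(1)[OF f]) (use p in auto)
    show "S n \<subseteq> S m" if "m \<le> n" for m n
    proof -
      have "1 / real (Suc n) \<le> 1 / real (Suc m)" using that by (simp add: frac_le)
      then show ?thesis unfolding S_def by (intro closure_mono) auto
    qed
  qed
  moreover have "\<Inter>(range S) = ?F"
  proof (intro equalityI subsetI)
    fix z assume z: "z \<in> \<Inter>(range S)"
    have zD: "z \<in> \<bbbD>" using z S_sub by blast
    have "p \<bullet> f z \<ge> 1 - e" if "e > 0" for e
    proof -
      obtain n where "1 / real (Suc n) < e" using \<open>e > 0\<close> by (metis nat_approx_posE)
      moreover have "p \<bullet> f z \<ge> 1 - 1 / real (Suc n)" using z S_sub by blast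
      ultimately show ?thesis by linarith
    qed
    then have "1 \<le> p \<bullet> f z + e" if "e > 0" for e using that by (simp add: diff_le_eq)
    then have "p \<bullet> f z \<ge> 1" by (rule field_le_epsilon)
    moreover have "norm (f z) \<le> 1" using fD zD by (metis image_subset_iff mem_cball_0)
    \<comment> \<open>This is the equality case of Cauchy-Schwarz: in the disc,
      \<open>p \<bullet> f z \<ge> 1\<close> forces \<open>f z = p\<close>.\<close>
    moreover have "(norm (p - f z))\<^sup>2 = (norm p)\<^sup>2 + (norm (f z))\<^sup>2 - 2 * (p \<bullet> f z)"
      by (simp add: power2_norm_eq_inner inner_diff inner_commute)
    moreover have "(norm (f z))\<^sup>2 \<le> 1" using calculation(2) by (simp add: abs_square_le_1)
    ultimately have "(norm (p - f z))\<^sup>2 \<le> 0" using p by simp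
    then show "z \<in> ?F" using zD by simp
  next
    fix z assume z: "z \<in> ?F"
    have "p \<bullet> p = 1" using p by (simp add: norm_eq_1)
    then have "z \<in> {z \<in> \<bbbD>. p \<bullet> f z > 1 - 1 / real (Suc n)}" for n using z by auto
    then show "z \<in> \<Inter>(range S)" unfolding S_def using closure_subset by blast
  qed
  ultimately show ?thesis by simp
qed

section \<open>Injectivity from lightness, surjectivity from boundary values\<close>

theorem mainTheorem1:
  fixes f :: "real^2 \<Rightarrow> real^2"
  assumes "f ` \<bbbD> \<subseteq> \<bbbD>"
    and "light_on \<bbbD> f"
    and "saddle_map f"
    and "\<forall>x \<in> \<partial>\<bbbD>. f x = x"
  shows "\<exists>g. homeomorphism \<bbbD> \<bbbD> f g"
proof (rule homeomorphism_compact)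
  show contf: "continuous_on \<bbbD> f" using assms(2) by (simp add: light_on_def)
  show "inj_on f \<bbbD>"
  proof (rule inj_onI)
    fix x y assume xy: "x \<in> \<bbbD>" "y \<in> \<bbbD>" "f x = f y"
    let ?F = "\<bbbD> \<inter> f -` {f x}"
    have "norm (f x) \<le> 1" using assms(1) xy(1) by (metis image_subset_iff mem_cball_0)
    then have "connected ?F"
      using connected_interior_fiber[OF assms(3,4)] connected_boundary_fiber[OF assms(3,4,1)]
      by (metis less_eq_real_def)
    \<comment> \<open>A nonempty connected fibre is its own only component, so lightness makes it a
      point.\<close>
    then have "?F \<in> components ?F"
      using xy(1) by (subst components_eq_sing_iff[THEN iffD2]) auto
    then obtain c where "?F = {c}"
      using assms(2) unfolding light_on_def totally_disconnected_def by blast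
    then show "x = y" using xy by (metis IntI singletonD vimage_singleton_eq)
  qed
  show "f ` \<bbbD> = \<bbbD>"
  proof (intro equalityI assms(1) subsetI)
    fix p assume p: "p \<in> \<bbbD>"
    show "p \<in> f ` \<bbbD>"
    proof (cases "norm p = 1")
      case True
      then show ?thesis using assms(4) p by (metis imageI mem_sphere_0)
    next
      case False
      \<comment> \<open>On the circle \<open>f z - p\<close> equals \<open>z - p\<close>, and
        \<open>p\<close> is interior, so a zero in the disc is forced.\<close>
      then have "\<exists>z\<in>\<bbbD>. cplx (f z - p) = 0"
        using p assms(4) by (intro zero_of_disc_extension continuous_intros contf) auto
      then show ?thesis by (auto simp: cplx_eq_0_iff)
    qed
  qed
qed simp

end
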